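(* Let $X$ and $Y$ be real or complex Banach spaces, not necessarily over the same field, and let $C$ be a closed, not necessarily proper, cone in $Y$. Let $T:C\to X$ be a surjective continuous additive positively homogeneous map. Then there exist a constant $K>0$ and a continuous positively homogeneous map $\gamma:X\to C$ such that: (1) $T\circ\gamma=\mathrm{id}_X$; (2) $\|\gamma(x)\|\leq K\|x\|$ for all $x\in X$.
   Context: A subset $C$ of a real or complex vector space is a cone if $C+C\subseteq C$ and $\lambda C\subseteq C$ for all real $\lambda\geq 0$; it is proper if $C\cap(-C)=\{0\}$ (not assumed here). A map $T$ defined on a cone is additive if $T(u+v)=Tu+Tv$, and a map $T$ between cones (a Banach space being a cone in itself) is positively homogeneous if $T(\lambda u)=\lambda T(u)$ for all $u$ in its domain and all real $\lambda\geq0$. *)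

theory Defs
  imports "HOL-Analysis.Analysis"
begin

text \<open>
  The class \<^class>\<open>banach\<close> is that of complete normed spaces over the reals. A complex Banach
  space is a member of it through the same addition and norm and the scalar multiplication by real
  numbers \<open>r *\<^sub>R x = (r + 0 i) x\<close>. Cones and positive homogeneity refer to real scalars only,
  so all notions below have the same meaning in a complex space as in its underlying real one.
\<close>

text \<open>The library's \<^const>\<open>cone\<close> requires closure under nonnegative scaling only, not under sums.\<close>

definition additive_cone :: "'a::real_vector set \<Rightarrow> bool" where
  "additive_cone C \<longleftrightarrow> (\<forall>u\<in>C. \<forall>v\<in>C. u + v \<in> C) \<and> (\<forall>r\<ge>0. \<forall>u\<in>C. r *\<^sub>R u \<in> C)"

definition additive_on :: "'a::plus set \<Rightarrow> ('a \<Rightarrow> 'b::plus) \<Rightarrow> bool" where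
  "additive_on C T \<longleftrightarrow> (\<forall>u\<in>C. \<forall>v\<in>C. T (u + v) = T u + T v)"

definition pos_homogeneous_on :: "'a::real_vector set \<Rightarrow> ('a \<Rightarrow> 'b::real_vector) \<Rightarrow> bool" where
  "pos_homogeneous_on C T \<longleftrightarrow> (\<forall>r\<ge>0. \<forall>u\<in>C. T (r *\<^sub>R u) = r *\<^sub>R T u)"

end

theory Submission imports Defs begin

text \<open>
  Since \<open>C\<close> is a closed cone, convergent sums of elements of \<open>C\<close> stay in \<open>C\<close>, and \<open>T\<close> may be applied
  to them term by term. Hence an approximate right inverse is enough: if \<open>s : X \<rightarrow> C\<close> satisfies
  \<open>\<parallel>s x\<parallel> \<le> K \<parallel>x\<parallel>\<close> and \<open>\<parallel>x - T (s x)\<parallel> \<le> \<parallel>x\<parallel> / 2\<close>, then, with the remainder \<open>R x = x - T (s x)\<close>, the series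
  \<open>\<gamma> x = \<Sum>n. s (R^n x)\<close> converges geometrically, and \<open>T (\<gamma> x) = \<Sum>n. (R^n x - R^(n+1) x)\<close>
  telescopes to \<open>x\<close> (lemma \<open>successive_approximation\<close>). Only sums of values of \<open>s\<close> occur, never
  differences, so the argument does not leave the cone; and \<open>\<gamma>\<close> inherits continuity and positive
  homogeneity from \<open>s\<close>. It is used twice: with an arbitrary \<open>s\<close> provided by Baire's theorem it gives
  an open mapping theorem for cones (\<open>bounded_lifting\<close>), and with a continuous positively
  homogeneous \<open>s\<close> it gives the claim.

  The continuous \<open>s\<close> is a weighted sum \<open>s x = \<Sum>a. g a x *\<^sub>R c a\<close>, where \<open>c a\<close> are bounded preimages of
  the unit vectors \<open>sgn a\<close>, and the weights \<open>g a x \<ge> 0\<close> are continuous, positively homogeneous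
  in \<open>x\<close>, have total \<open>\<parallel>x\<parallel>\<close>, and vanish unless \<open>\<parallel>x\<parallel> sgn a\<close> is close to \<open>x\<close>
  (\<open>exists_homogeneous_partition\<close>). One
  well-orders \<open>X\<close>, takes bumps \<open>f a\<close> whose pointwise maximum is \<open>\<parallel>x\<parallel>\<close>, and lets \<open>g a x\<close> be the amount by
  which \<open>f a x\<close> raises the running supremum of the earlier bumps; these increments telescope
  transfinitely to the maximum. Since the weights are nonnegative and both each of them and their
  total are continuous, the weighted sum is continuous too, by the argument of Scheffe's lemma.
\<close>

section \<open>Increments of running suprema along a well-order\<close>

text \<open>
  The family \<open>h\<close> is the supremum of the earlier values and \<open>g\<close> its jump at each index. Finitely many
  jumps never overshoot a bound of \<open>f\<close>, as one sees by removing the last of them. Conversely,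
  by well-founded induction, the jumps up to an index already add up to at least the value of \<open>f\<close>
  there; at limit stages this works because \<open>h\<close> is a supremum of earlier values and so has no jump
  of its own. The value \<open>0\<close> is put into the suprema to start the running supremum at \<open>0\<close>.
\<close>

lemma sum_running_max_increments:
  fixes f g h :: "'i \<Rightarrow> real"
  assumes wf: "wf r" and trans: "trans r" and total: "total r"
    and f0: "\<And>a. 0 \<le> f a" and fM: "\<And>a. f a \<le> f m"
    and h: "\<And>a. h a = Sup (insert 0 (f ` {b. (b, a) \<in> r}))"
    and g: "\<And>a. g a = max 0 (f a - h a)"
  shows "(g has_sum f m) UNIV"
proof -
  have bdd: "bdd_above (insert 0 (f ` {b. (b, a) \<in> r}))" for a
    using fM by (auto intro!: bdd_aboveI2)
  have h0: "0 \<le> h a" for a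
    unfolding h by (rule cSup_upper) (use bdd in auto)
  have fh: "f b \<le> h a" if "(b, a) \<in> r" for a b
    unfolding h by (rule cSup_upper) (use bdd that in auto)
  have h_le: "h a \<le> B" if "0 \<le> B" "\<And>b. (b, a) \<in> r \<Longrightarrow> f b \<le> B" for a B
    unfolding h by (rule cSup_least) (use that in auto)
  have hh: "h b \<le> h a" if "(b, a) \<in> r" for a b
    using h_le[of "h a" b] h0 fh transD[OF trans _ that] by blast
  have g0: "0 \<le> g a" for a
    by (simp add: g)
  have upper: "sum g F \<le> B" if "finite F" "0 \<le> B" "\<And>a. a \<in> F \<Longrightarrow> f a \<le> B \<and> h a \<le> B" for F B
    using that
  proof (induction F arbitrary: B rule: finite_psubset_induct)
    case (psubset F)
    show ?case
    proof (cases "F = {}")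
      case False
      \<comment> \<open>the last index of \<open>F\<close>: all other jumps add up to at most the height just before it\<close>
      have "\<exists>k\<in>F. \<forall>b\<in>F. b = k \<or> (b, k) \<in> r"
        using psubset.hyps False
      proof (induction rule: finite_ne_induct)
        case (insert x F)
        then obtain k where k: "k \<in> F" "\<forall>b\<in>F. b = k \<or> (b, k) \<in> r" by blast
        show ?case
        proof (cases "(k, x) \<in> r")
          case True
          have "b = x \<or> (b, x) \<in> r" if "b \<in> insert x F" for b
            using that k(2) True transD[OF trans _ True, of b] by auto
          then show ?thesis by blast
        next
          case False
          then have "x = k \<or> (x, k) \<in> r" using total unfolding total_on_def by (metis UNIV_I)
          with k have "\<forall>b\<in>insert x F. b = k \<or> (b, k) \<in> r" by simp
          then show ?thesis using k(1) by blast
        qed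
      qed auto
      then obtain k where k: "k \<in> F" "\<And>b. b \<in> F \<Longrightarrow> b = k \<or> (b, k) \<in> r" by blast
      have "F - {k} \<subset> F" using k(1) by blast
      moreover have "f b \<le> h k \<and> h b \<le> h k" if "b \<in> F - {k}" for b
        using k(2)[of b] that fh[of b k] hh[of b k] by auto
      ultimately have "sum g (F - {k}) \<le> h k"
        using psubset.IH h0 by blast
      moreover have "sum g F = g k + sum g (F - {k})"
        using psubset.hyps k by (simp add: sum.remove)
      ultimately show ?thesis
        using psubset.prems(2)[OF k(1)] unfolding g[of k] by linarith
    qed (use psubset.prems in simp)
  qed
  have "h a \<le> f m" for a
    by (rule h_le) (use f0 fM in auto)
  then have sum_le: "sum g F \<le> f m" if "finite F" for F
    by (intro upper that) (use f0 fM in auto)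
  then have bdd': "bdd_above (sum g ` {F. F \<subseteq> A \<and> finite F})" for A
    by (auto intro!: bdd_aboveI2)
  have summable: "g summable_on A" for A
    by (rule nonneg_bdd_above_summable_on) (use g0 bdd' in auto)
  have lower: "f a \<le> infsum g (insert a {b. (b, a) \<in> r})" for a
    using wf
  proof (induction a rule: wf_induct_rule)
    case (less a)
    have irr: "(a, a) \<notin> r" using wf by (simp add: wf_irrefl)
    have "h a \<le> infsum g {b. (b, a) \<in> r}"
    proof (rule h_le)
      show "0 \<le> infsum g {b. (b, a) \<in> r}" by (rule infsum_nonneg) (rule g0)
    next
      fix b assume b: "(b, a) \<in> r"
      have "infsum g (insert b {c. (c, b) \<in> r}) \<le> infsum g {b. (b, a) \<in> r}"
        by (rule infsum_mono2) (use summable g0 b transD[OF trans _ b] in auto)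
      with less[OF b] show "f b \<le> infsum g {b. (b, a) \<in> r}" by linarith
    qed
    moreover have "infsum g (insert a {b. (b, a) \<in> r}) = g a + infsum g {b. (b, a) \<in> r}"
      using infsum_Un_disjoint[of g "{a}" "{b. (b, a) \<in> r}"] summable irr by simp
    ultimately show ?case using g[of a] by linarith
  qed
  have "infsum g (insert m {b. (b, m) \<in> r}) \<le> infsum g UNIV"
    by (rule infsum_mono2) (use summable g0 in auto)
  with lower[of m] have "f m \<le> infsum g UNIV" by linarith
  moreover have "infsum g UNIV \<le> f m"
    by (rule infsum_le_finite_sums) (use summable sum_le in auto)
  ultimately have "infsum g UNIV = f m" by linarith
  with summable[of UNIV] show ?thesis by (metis has_sum_infsum)
qed

text \<open>
  A common Lipschitz constant passes to arbitrary suprema, unlike mere continuity. This is what makes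
  the increments of a running supremum continuous at limit stages of the well-order.
\<close>

lemma lipschitz_on_running_sup:
  fixes f :: "'i \<Rightarrow> 'x::metric_space \<Rightarrow> real"
  assumes lip: "\<And>b. L-lipschitz_on UNIV (f b)"
    and bdd: "\<And>x. bdd_above (range (\<lambda>b. f b x))"
    and L: "0 \<le> L"
  shows "L-lipschitz_on UNIV (\<lambda>x. Sup (insert 0 ((\<lambda>b. f b x) ` B)))"
proof -
  define S where "S = (\<lambda>x. Sup (insert 0 ((\<lambda>b. f b x) ` B)))"
  have bdd': "bdd_above (insert 0 ((\<lambda>b. f b x) ` B))" for x
    using bdd_above_mono[OF bdd[of x], of "(\<lambda>b. f b x) ` B"] by (simp add: image_mono)
  have *: "S x \<le> S y + L * dist x y" for x y
  proof -
    have le: "v \<le> S y" if "v \<in> insert 0 ((\<lambda>b. f b y) ` B)" for v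
      unfolding S_def by (rule cSup_upper[OF that bdd'])
    have "t \<le> S y + L * dist x y" if t: "t \<in> insert 0 ((\<lambda>b. f b x) ` B)" for t
    proof (cases "t = 0")
      case True
      then show ?thesis using le[of 0] L by simp
    next
      case False
      then obtain b where b: "b \<in> B" "t = f b x" using t by auto
      have "dist (f b x) (f b y) \<le> L * dist x y"
        using lip[of b] by (auto simp: lipschitz_on_def)
      then show ?thesis using le[of "f b y"] b by (auto simp: dist_real_def)
    qed
    then show ?thesis by (subst S_def) (rule cSup_least, auto)
  qed
  show ?thesis
    unfolding S_def[symmetric]
  proof (rule lipschitz_onI[OF _ L])
    fix x y
    show "dist (S x) (S y) \<le> L * dist x y"
      using *[of x y] *[of y x] by (auto simp: dist_real_def dist_commute abs_le_iff)
  qed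
qed

section \<open>Continuity of infinite weighted sums\<close>

text \<open>
  If a finite set of weights nearly exhausts the total at \<open>x0\<close>, it does so in a neighbourhood of
  \<open>x0\<close>, because the missing mass is a continuous function of \<open>x\<close>. By nonnegativity the missing mass
  bounds the tail of the weighted sum, which is therefore small near \<open>x0\<close> uniformly in \<open>x\<close>.
\<close>

lemma continuous_on_has_sum_scaleR:
  fixes g :: "'i \<Rightarrow> 'x::topological_space \<Rightarrow> real" and c :: "'i \<Rightarrow> 'y::real_normed_vector"
  assumes g0: "\<And>a x. 0 \<le> g a x"
    and g: "\<And>a. continuous_on UNIV (g a)"
    and s: "\<And>x. ((\<lambda>a. g a x) has_sum s x) UNIV" and cs: "continuous_on UNIV s"
    and c: "\<And>a. norm (c a) \<le> K"
    and G: "\<And>x. ((\<lambda>a. g a x *\<^sub>R c a) has_sum G x) UNIV"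
  shows "continuous_on UNIV G"
proof -
  have K: "0 \<le> K" using c norm_ge_zero order_trans by blast
  have tail: "norm (G x - (\<Sum>a\<in>F. g a x *\<^sub>R c a)) \<le> K * (s x - (\<Sum>a\<in>F. g a x))" if "finite F" for F x
  proof -
    have 1: "((\<lambda>a. g a x *\<^sub>R c a) has_sum G x - (\<Sum>a\<in>F. g a x *\<^sub>R c a)) (UNIV - F)"
      by (rule has_sum_Diff[OF G has_sum_finite]) (use that in auto)
    have "((\<lambda>a. g a x) has_sum s x - (\<Sum>a\<in>F. g a x)) (UNIV - F)"
      by (rule has_sum_Diff[OF s has_sum_finite]) (use that in auto)
    then have 2: "((\<lambda>a. K * g a x) has_sum K * (s x - (\<Sum>a\<in>F. g a x))) (UNIV - F)"
      by (rule has_sum_cmult_right)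
    have le: "norm (g a x *\<^sub>R c a) \<le> K * g a x" for a
      using mult_right_mono[OF c g0] g0 by (simp add: mult.commute)
    have 3: "(\<lambda>a. norm (g a x *\<^sub>R c a)) summable_on (UNIV - F)"
      by (rule summable_on_comparison_test[OF has_sum_imp_summable[OF 2]]) (use le in auto)
    have "norm (G x - (\<Sum>a\<in>F. g a x *\<^sub>R c a)) \<le> infsum (\<lambda>a. norm (g a x *\<^sub>R c a)) (UNIV - F)"
      by (rule norm_has_sum_bound[OF has_sum_infsum[OF 3] 1])
    also have "\<dots> \<le> K * (s x - (\<Sum>a\<in>F. g a x))"
      by (rule has_sum_mono[OF has_sum_infsum[OF 3] 2]) (use le in auto)
    finally show ?thesis .
  qed
  have "(G \<longlongrightarrow> G x0) (at x0)" for x0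
  proof (rule tendstoI)
    fix e :: real assume e: "0 < e"
    \<comment> \<open>\<open>K + 1\<close> instead of \<open>K\<close>, as \<open>K\<close> may be \<open>0\<close>\<close>
    define d where "d = e / (3 * (K + 1))"
    have d: "0 < d" using e K by (simp add: d_def)
    have Kd: "K * t \<le> e / 3" if "t < d" for t
    proof -
      have "K * t \<le> K * d" using that K by (simp add: mult_left_mono)
      also have "\<dots> \<le> (K + 1) * d" using d by (simp add: algebra_simps)
      also have "\<dots> = e / 3" using K by (simp add: d_def field_simps)
      finally show ?thesis .
    qed
    obtain F where F: "finite F" "dist (\<Sum>a\<in>F. g a x0) (s x0) \<le> d / 2"
      using has_sum_finite_approximation[OF s[of x0], of "d / 2"] d by auto
    have F0: "s x0 - (\<Sum>a\<in>F. g a x0) < d"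
      using F(2) d unfolding dist_real_def by linarith
    have "continuous_on UNIV (\<lambda>x. s x - (\<Sum>a\<in>F. g a x))"
      by (intro continuous_intros cs g)
    then have "((\<lambda>x. s x - (\<Sum>a\<in>F. g a x)) \<longlongrightarrow> s x0 - (\<Sum>a\<in>F. g a x0)) (at x0)"
      by (simp add: continuous_on_def)
    then have ev1: "\<forall>\<^sub>F x in at x0. s x - (\<Sum>a\<in>F. g a x) < d"
      by (rule order_tendstoD) (rule F0)
    have "continuous_on UNIV (\<lambda>x. \<Sum>a\<in>F. g a x *\<^sub>R c a)"
      by (intro continuous_intros g)
    then have "((\<lambda>x. \<Sum>a\<in>F. g a x *\<^sub>R c a) \<longlongrightarrow> (\<Sum>a\<in>F. g a x0 *\<^sub>R c a)) (at x0)"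
      by (simp add: continuous_on_def)
    then have ev2: "\<forall>\<^sub>F x in at x0. dist (\<Sum>a\<in>F. g a x *\<^sub>R c a) (\<Sum>a\<in>F. g a x0 *\<^sub>R c a) < e / 3"
      by (rule tendstoD) (use e in simp)
    show "\<forall>\<^sub>F x in at x0. dist (G x) (G x0) < e"
      using ev1 ev2
    proof eventually_elim
      case (elim x)
      define P where "P = (\<lambda>x. \<Sum>a\<in>F. g a x *\<^sub>R c a)"
      have "dist (G x) (P x) \<le> e / 3" 
        using tail[OF F(1), of x] Kd[OF elim(1)] by (simp add: dist_norm P_def)
      moreover have "dist (G x0) (P x0) \<le> e / 3"
        using tail[OF F(1), of x0] Kd[OF F0] by (simp add: dist_norm P_def)
      moreover have "dist (P x) (P x0) < e / 3" using elim(2) by (simp add: P_def)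
      moreover have "dist (G x) (G x0) \<le> dist (G x) (P x) + dist (P x) (P x0) + dist (G x0) (P x0)"
        using dist_triangle[of "G x" "G x0" "P x"] dist_triangle[of "P x" "G x0" "P x0"]
        by (simp add: dist_commute)
      ultimately show ?case by linarith
    qed
  qed
  then show ?thesis by (simp add: continuous_on_def)
qed

section \<open>A homogeneous partition of the norm\<close>

text \<open>
  A partition of unity on the unit sphere into pieces of small diameter, extended radially.
  The bump \<open>f a x = max 0 (\<parallel>x\<parallel> - 2 \<parallel>x - \<parallel>x\<parallel> sgn a\<parallel>)\<close> is at most \<open>\<parallel>x\<parallel>\<close>, with equality for \<open>a = x\<close>, and
  it is positive only where \<open>\<parallel>x\<parallel> sgn a\<close> is within \<open>\<parallel>x\<parallel> / 2\<close> of \<open>x\<close>. So the maximum of the bumps is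
  exactly \<open>\<parallel>x\<parallel>\<close>, and their increments along a well-order need no normalisation. Indexing by all vectors
  through \<open>sgn\<close>, rather than by unit vectors, keeps the index set a type and covers
  the zero space, which has no unit vectors.
\<close>

lemma exists_homogeneous_partition:
  "\<exists>g :: 'x::real_normed_vector \<Rightarrow> 'x \<Rightarrow> real.
     (\<forall>a x. 0 \<le> g a x) \<and> (\<forall>x. ((\<lambda>a. g a x) has_sum norm x) UNIV) \<and>
     (\<forall>a. continuous_on UNIV (g a)) \<and>
     (\<forall>a x. \<forall>t\<ge>0. g a (t *\<^sub>R x) = t * g a x) \<and>
     (\<forall>a x. 0 < g a x \<longrightarrow> norm (x - norm x *\<^sub>R sgn a) \<le> norm x / 2)"
proof -
  obtain w :: "'x rel" where w: "Well_order w" "Field w = UNIV"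
    using well_ordering by metis
  define r where "r = w - Id"
  have r: "wf r" "trans r" "total r"
    using w unfolding r_def order_on_defs by (simp_all add: trans_diff_Id)
  define f :: "'x \<Rightarrow> 'x \<Rightarrow> real"
    where "f = (\<lambda>a x. max 0 (norm x - 2 * norm (x - norm x *\<^sub>R sgn a)))"
  define h where "h = (\<lambda>a x. Sup (insert 0 ((\<lambda>b. f b x) ` {b. (b, a) \<in> r})))"
  define g where "g = (\<lambda>a x. max 0 (f a x - h a x))"
  have f0: "0 \<le> f a x" for a x by (simp add: f_def)
  have f_norm: "f a x \<le> norm x" for a x by (simp add: f_def)
  have f_self: "f x x = norm x" for x by (cases "x = 0") (simp_all add: f_def sgn_div_norm)
  have bdd: "bdd_above (range (\<lambda>b. f b x))" for x
    by (rule bdd_aboveI2[where M = "norm x"]) (rule f_norm)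
  have bdd': "bdd_above (insert 0 ((\<lambda>b. f b x) ` B))" for x B
    using bdd_above_mono[OF bdd[of x], of "(\<lambda>b. f b x) ` B"] by (simp add: image_mono)
  have h0: "0 \<le> h a x" for a x
    unfolding h_def by (rule cSup_upper[OF _ bdd']) simp
  have "((\<lambda>a. g a x) has_sum norm x) UNIV" for x
    using sum_running_max_increments[OF r, where f = "\<lambda>b. f b x" and h = "\<lambda>a. h a x" and m = x
        and g = "\<lambda>a. g a x"]
    by (simp add: f0 f_norm f_self h_def g_def)
  moreover have "continuous_on UNIV (g a)" for a
  proof -
    have lip: "5-lipschitz_on UNIV (f b)" for b
    proof (rule lipschitz_onI)
      fix x y :: 'x
      define u where "u = sgn b"
      have u: "norm u \<le> 1" by (simp add: u_def norm_sgn)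
      have "norm ((x - norm x *\<^sub>R u) - (y - norm y *\<^sub>R u))
          = norm ((x - y) - (norm x - norm y) *\<^sub>R u)"
        by (simp add: algebra_simps)
      also have "\<dots> \<le> norm (x - y) + \<bar>norm x - norm y\<bar> * norm u"
        using norm_triangle_ineq4[of "x - y" "(norm x - norm y) *\<^sub>R u"] by simp
      also have "\<dots> \<le> norm (x - y) + norm (x - y) * 1"
        using u by (intro add_left_mono mult_mono norm_triangle_ineq3) auto
      finally have "\<bar>norm (x - norm x *\<^sub>R u) - norm (y - norm y *\<^sub>R u)\<bar> \<le> 2 * norm (x - y)"
        using norm_triangle_ineq3[of "x - norm x *\<^sub>R u" "y - norm y *\<^sub>R u"] by linarith
      moreover have "\<bar>max 0 p - max 0 q\<bar> \<le> \<bar>p - q\<bar>" for p q :: real by (auto simp: max_def)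
      moreover note norm_triangle_ineq3[of x y]
      ultimately show "dist (f b x) (f b y) \<le> 5 * dist x y"
        unfolding f_def u_def[symmetric] dist_norm real_norm_def by (smt (verit))
    qed simp
    have "5-lipschitz_on UNIV (h a)"
      unfolding h_def by (rule lipschitz_on_running_sup[OF lip bdd]) simp
    with lip[of a] have "continuous_on UNIV (f a)" "continuous_on UNIV (h a)"
      by (auto intro: lipschitz_on_continuous_on)
    then show ?thesis unfolding g_def by (intro continuous_intros)
  qed
  moreover have "g a (t *\<^sub>R x) = t * g a x" if t: "0 \<le> t" for a t x
  proof -
    have f_hom: "f b (t *\<^sub>R x) = t * f b x" for b
    proof -
      have "t *\<^sub>R x - (t * norm x) *\<^sub>R sgn b = t *\<^sub>R (x - norm x *\<^sub>R sgn b)"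
        by (simp add: scaleR_right_diff_distrib)
      then show ?thesis using t
        by (simp add: f_def max_mult_distrib_left right_diff_distrib)
    qed
    \<comment> \<open>continuity and monotonicity of scaling, rather than order isomorphism, so that \<open>t = 0\<close> is included\<close>
    have "t * Sup (insert 0 ((\<lambda>b. f b x) ` {b. (b, a) \<in> r}))
        = (SUP s\<in>insert 0 ((\<lambda>b. f b x) ` {b. (b, a) \<in> r}). t * s)"
      using t by (intro continuous_at_Sup_mono bdd' monoI mult_left_mono continuous_intros) auto
    then have "h a (t *\<^sub>R x) = t * h a x"
      by (simp add: h_def f_hom image_image)
    then show ?thesis using t by (simp add: g_def f_hom max_mult_distrib_left right_diff_distrib)
  qed
  moreover have "norm (x - norm x *\<^sub>R sgn a) \<le> norm x / 2" if "0 < g a x" for a x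
  proof -
    have "0 < f a x" using that h0[of a x] by (auto simp: g_def)
    then show ?thesis by (auto simp: f_def)
  qed
  moreover have "0 \<le> g a x" for a x by (simp add: g_def)
  ultimately show ?thesis by (intro exI[of _ g] conjI allI impI) simp_all
qed

section \<open>Lifting through a surjection of a closed cone\<close>

locale cone_surjection =
  fixes C :: "'y::banach set" and T :: "'y \<Rightarrow> 'x::banach"
  assumes closed: "closed C"
    and cone: "additive_cone C"
    and surj: "T ` C = UNIV"
    and cont: "continuous_on C T"
    and additive: "additive_on C T"
    and pos_hom: "pos_homogeneous_on C T"
begin

lemma add_mem: "u \<in> C \<Longrightarrow> v \<in> C \<Longrightarrow> u + v \<in> C"
  using cone by (simp add: additive_cone_def)

lemma scaleR_mem: "0 \<le> r \<Longrightarrow> u \<in> C \<Longrightarrow> r *\<^sub>R u \<in> C"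
  using cone by (simp add: additive_cone_def)

lemma map_add: "u \<in> C \<Longrightarrow> v \<in> C \<Longrightarrow> T (u + v) = T u + T v"
  using additive by (simp add: additive_on_def)

lemma map_scaleR: "0 \<le> r \<Longrightarrow> u \<in> C \<Longrightarrow> T (r *\<^sub>R u) = r *\<^sub>R T u"
  using pos_hom by (simp add: pos_homogeneous_on_def)

lemma zero_mem: "0 \<in> C"
proof -
  obtain u where "u \<in> C" using surj by blast
  then show ?thesis using scaleR_mem[of 0 u] by simp
qed

lemma map_zero: "T 0 = 0"
  using map_scaleR[of 0 0] zero_mem by simp

lemma sum_mem: "(\<And>a. a \<in> F \<Longrightarrow> c a \<in> C) \<Longrightarrow> sum c F \<in> C"
  by (induction F rule: infinite_finite_induct) (auto simp: zero_mem add_mem)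

lemma map_sum: "(\<And>a. a \<in> F \<Longrightarrow> c a \<in> C) \<Longrightarrow> T (sum c F) = (\<Sum>a\<in>F. T (c a))"
  by (induction F rule: infinite_finite_induct) (auto simp: map_zero map_add sum_mem)

lemma has_sum_mem:
  assumes "(c has_sum s) A" "\<And>a. c a \<in> C"
  shows "s \<in> C"
  by (rule Lim_in_closed_set[OF closed _ _ assms(1)[unfolded has_sum_def]])
    (auto intro: always_eventually sum_mem assms(2))

lemma map_has_sum:
  assumes "(c has_sum s) A" "\<And>a. c a \<in> C"
  shows "((\<lambda>a. T (c a)) has_sum T s) A"
proof -
  have "((\<lambda>F. T (sum c F)) \<longlongrightarrow> T s) (finite_subsets_at_top A)"
    by (rule continuous_on_tendsto_compose[OF cont assms(1)[unfolded has_sum_def] has_sum_mem[OF assms]])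
      (auto intro: always_eventually sum_mem assms(2))
  then show ?thesis by (simp add: has_sum_def map_sum assms(2))
qed

text \<open>
  The remainder \<open>R x\<close> at least halves the norm, so the \<open>n\<close>-th term is of order \<open>2^(-n)\<close>, and
  \<open>T (s (R^n x)) = R^n x - R^(n+1) x\<close> telescopes. The bound on the single terms is part of the
  conclusion because it gives the uniform convergence from which \<open>G\<close> inherits continuity.
\<close>

lemma successive_approximation:
  assumes mem: "\<And>x. s x \<in> C" and bound: "\<And>x. norm (s x) \<le> K * norm x"
    and approx: "\<And>x. norm (x - T (s x)) \<le> norm x / 2" and K: "0 \<le> K"
  defines "R \<equiv> \<lambda>x. x - T (s x)"
  defines "G \<equiv> \<lambda>x. \<Sum>\<^sub>\<infinity>n. s ((R ^^ n) x)"
  shows "norm (s ((R ^^ n) x)) \<le> K * norm x * (1 / 2) ^ n"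
    and "((\<lambda>n. s ((R ^^ n) x)) has_sum G x) UNIV"
    and "G x \<in> C" and "T (G x) = x" and "norm (G x) \<le> 2 * K * norm x"
proof -
  have R_bound: "norm ((R ^^ n) x) \<le> norm x * (1 / 2) ^ n" for n
  proof (induction n)
    case (Suc n)
    have "norm ((R ^^ Suc n) x) \<le> norm ((R ^^ n) x) / 2"
      using approx[of "(R ^^ n) x"] by (simp add: R_def)
    with Suc show ?case by simp
  qed simp
  show s_bound: "norm (s ((R ^^ n) x)) \<le> K * norm x * (1 / 2) ^ n" for n
    using order_trans[OF bound[of "(R ^^ n) x"] mult_left_mono[OF R_bound[of n] K]]
    by (simp add: mult.assoc)
  have geo: "((\<lambda>n. K * norm x * (1 / 2) ^ n) has_sum 2 * K * norm x) (UNIV :: nat set)"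
  proof -
    have "((\<lambda>n. (1 / 2) ^ n) has_sum (2 :: real)) UNIV"
      using geometric_sums[of "1 / 2 :: real"] by (intro sums_nonneg_imp_has_sum) simp_all
    from has_sum_cmult_right[OF this, of "K * norm x"] show ?thesis by (simp add: mult_ac)
  qed
  have abs: "(\<lambda>n. norm (s ((R ^^ n) x))) summable_on UNIV"
    by (rule summable_on_comparison_test[OF has_sum_imp_summable[OF geo]]) (use s_bound in auto)
  show sum: "((\<lambda>n. s ((R ^^ n) x)) has_sum G x) UNIV"
    unfolding G_def using abs_summable_summable[OF abs] by simp
  show "G x \<in> C" by (rule has_sum_mem[OF sum mem])
  have "norm (G x) \<le> infsum (\<lambda>n. norm (s ((R ^^ n) x))) UNIV"
    by (rule norm_has_sum_bound[OF has_sum_infsum[OF abs] sum])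
  also have "\<dots> \<le> 2 * K * norm x"
    by (rule has_sum_mono[OF has_sum_infsum[OF abs] geo]) (use s_bound in auto)
  finally show "norm (G x) \<le> 2 * K * norm x" .
  have "(\<lambda>n. T (s ((R ^^ n) x))) sums T (G x)"
    by (rule has_sum_imp_sums[OF map_has_sum[OF sum mem]])
  moreover have "(\<lambda>n. T (s ((R ^^ n) x))) sums x"
  proof -
    have "(\<lambda>n. (R ^^ n) x) \<longlonglongrightarrow> 0"
    proof (rule Lim_null_comparison)
      show "\<forall>\<^sub>F n in sequentially. norm ((R ^^ n) x) \<le> norm x * (1 / 2) ^ n"
        using R_bound by simp
      show "(\<lambda>n. norm x * (1 / 2) ^ n) \<longlonglongrightarrow> 0"
        by (intro tendsto_mult_right_zero LIMSEQ_power_zero) simp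
    qed
    from telescope_sums'[OF this] show ?thesis by (simp add: R_def)
  qed
  ultimately show "T (G x) = x" by (rule sums_unique2)
qed

text \<open>
  By Baire's theorem the closure of the image of some bounded part of \<open>C\<close> contains a ball around a
  point \<open>x0\<close>. In a linear space one would recentre the ball by subtraction; in a cone one adds instead
  a preimage \<open>c0\<close> of \<open>- x0\<close>, which exists since \<open>T\<close> is onto the whole space and not just onto a cone.
\<close>

lemma approximate_lifting:
  "\<exists>K>0. \<forall>x. \<forall>e>0. \<exists>c\<in>C. norm c \<le> K * norm x \<and> norm (x - T c) < e"
proof -
  define A where "A = (\<lambda>n::nat. closure (T ` (C \<inter> cball 0 (real n))))"
  have "\<exists>n. interior (A n) \<noteq> {}"
  proof (rule ccontr)
    assume "\<not> ?thesis"
    then have "euclidean interior_of \<Union>(range A) = {}"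
      by (intro Baire_category_alt) (auto simp: A_def completely_metrizable_space_euclidean)
    moreover have "x \<in> \<Union>(range A)" for x
    proof -
      obtain c where c: "c \<in> C" "x = T c" using surj by blast
      obtain n :: nat where "norm c \<le> real n" using real_arch_simple by blast
      then have "x \<in> A n" unfolding A_def using c by (intro subsetD[OF closure_subset]) auto
      then show ?thesis by blast
    qed
    then have "\<Union>(range A) = UNIV" by blast
    ultimately show False by simp
  qed
  then obtain n x0 where "x0 \<in> interior (A n)" by blast
  then obtain r where r: "0 < r" "ball x0 r \<subseteq> A n"
    by (meson interior_subset open_contains_ball open_interior order_trans)
  obtain c0 where c0: "c0 \<in> C" "T c0 = - x0" using surj by (metis UNIV_I imageE)
  define M where "M = real n + norm c0"
  have ball: "\<exists>c\<in>C. norm c \<le> M \<and> norm (y - T c) < e" if "norm y < r" "0 < e" for y e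
  proof -
    have "x0 + y \<in> ball x0 r" using \<open>norm y < r\<close> by (simp add: dist_norm)
    then have "x0 + y \<in> A n" using r(2) by blast
    then obtain c where c: "c \<in> C" "norm c \<le> real n" "dist (T c) (x0 + y) < e"
      using \<open>0 < e\<close> unfolding A_def closure_approachable by auto
    have "y - T (c + c0) = x0 + y - T c" using c c0 by (simp add: map_add)
    then have "norm (y - T (c + c0)) < e" using c(3) by (simp only: dist_norm norm_minus_commute)
    moreover have "norm (c + c0) \<le> M" unfolding M_def using norm_triangle_ineq[of c c0] c(2) by linarith
    ultimately show ?thesis using add_mem[OF c(1) c0(1)] by blast
  qed
  \<comment> \<open>\<open>2 / r\<close> scales \<open>x\<close> into the open ball of radius \<open>r\<close>; \<open>M + 1\<close> replaces \<open>M\<close> to make \<open>K\<close> positive\<close>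
  define K where "K = 2 * (M + 1) / r"
  have M: "0 \<le> M" by (simp add: M_def)
  have "\<exists>c\<in>C. norm c \<le> K * norm x \<and> norm (x - T c) < e" if e: "0 < e" for x e
  proof (cases "x = 0")
    case True
    then show ?thesis using e zero_mem map_zero by (intro bexI[of _ 0]) auto
  next
    case False
    define t where "t = 2 * norm x / r"
    have t: "0 < t" using False r by (simp add: t_def)
    have "norm (x /\<^sub>R t) < r" using False r by (simp add: t_def field_simps)
    then obtain c where c: "c \<in> C" "norm c \<le> M" "norm (x /\<^sub>R t - T c) < e / t"
      using ball[of "x /\<^sub>R t" "e / t"] e t by auto
    have "norm (t *\<^sub>R c) \<le> t * M" using c(2) t by simp
    also have "\<dots> \<le> K * norm x" using r by (simp add: K_def t_def field_simps)
    finally have 1: "norm (t *\<^sub>R c) \<le> K * norm x" .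
    have "x - T (t *\<^sub>R c) = t *\<^sub>R (x /\<^sub>R t - T c)" using t c(1) by (simp add: map_scaleR scaleR_right_diff_distrib)
    then have "norm (x - T (t *\<^sub>R c)) = t * norm (x /\<^sub>R t - T c)" using t by simp
    also have "\<dots> < e" using c(3) t by (simp add: field_simps)
    finally have "norm (x - T (t *\<^sub>R c)) < e" .
    with 1 show ?thesis using scaleR_mem[of t c] t c(1) by (intro bexI[of _ "t *\<^sub>R c"] conjI) simp_all
  qed
  moreover have "0 < K" using M r by (simp add: K_def)
  ultimately show ?thesis by blast
qed

text \<open>
  The open mapping theorem for cones, by successive approximation from a choice, with no regularity in
  \<open>x\<close>, of approximate preimages.
\<close>

lemma bounded_lifting: "\<exists>K>0. \<forall>x. \<exists>c\<in>C. T c = x \<and> norm c \<le> K * norm x"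
proof -
  obtain K where K: "0 < K" "\<And>x e. 0 < e \<Longrightarrow> \<exists>c\<in>C. norm c \<le> K * norm x \<and> norm (x - T c) < e"
    using approximate_lifting by metis
  have "\<exists>c\<in>C. norm c \<le> K * norm x \<and> norm (x - T c) \<le> norm x / 2" for x
  proof (cases "x = 0")
    case True
    then show ?thesis using zero_mem map_zero by (intro bexI[of _ 0]) auto
  next
    case False
    then show ?thesis using K(2)[of "norm x / 2" x] by (auto intro: less_imp_le)
  qed
  then obtain s where "\<And>x. s x \<in> C" "\<And>x. norm (s x) \<le> K * norm x" "\<And>x. norm (x - T (s x)) \<le> norm x / 2"
    by metis
  note approx = successive_approximation[OF this less_imp_le[OF K(1)]]
  show ?thesis using approx(3-5) K(1) by (intro exI[of _ "2 * K"]) auto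
qed

text \<open>
  Bounded preimages of unit vectors are blended by the homogeneous partition. As the weights at \<open>x\<close> have
  total \<open>\<parallel>x\<parallel>\<close>, the error satisfies \<open>\<parallel>x\<parallel> (x - T (s x)) = \<Sum>a. g a x (x - \<parallel>x\<parallel> sgn a)\<close>, and every
  nonzero term on the right has its vector of norm at most \<open>\<parallel>x\<parallel> / 2\<close>.
\<close>

lemma continuous_approximate_lifting:
  "\<exists>K>0. \<exists>s. (\<forall>x. s x \<in> C) \<and> (\<forall>x. norm (s x) \<le> K * norm x) \<and>
     (\<forall>x. norm (x - T (s x)) \<le> norm x / 2) \<and>
     continuous_on UNIV s \<and> pos_homogeneous_on UNIV s"
proof -
  obtain K where K: "0 < K" and "\<And>x. \<exists>c\<in>C. T c = x \<and> norm c \<le> K * norm x"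
    using bounded_lifting by blast
  then have "\<exists>c\<in>C. T c = sgn a \<and> norm c \<le> K * norm (sgn a)" for a :: 'x by blast
  moreover have "K * norm (sgn a) \<le> K" for a :: 'x using K by (simp add: norm_sgn)
  ultimately have "\<exists>c\<in>C. T c = sgn a \<and> norm c \<le> K" for a :: 'x
    by (meson order_trans)
  then obtain c where c: "\<And>a. c a \<in> C" "\<And>a. T (c a) = sgn a" "\<And>a. norm (c a) \<le> K"
    by metis
  obtain g :: "'x \<Rightarrow> 'x \<Rightarrow> real" where g0: "\<And>a x. 0 \<le> g a x"
    and g_sum: "\<And>x. ((\<lambda>a. g a x) has_sum norm x) UNIV"
    and g_cont: "\<And>a. continuous_on UNIV (g a)"
    and g_hom: "\<And>a x t. 0 \<le> t \<Longrightarrow> g a (t *\<^sub>R x) = t * g a x"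
    and g_near: "\<And>a x. 0 < g a x \<Longrightarrow> norm (x - norm x *\<^sub>R sgn a) \<le> norm x / 2"
    using exists_homogeneous_partition by metis
  define s where "s = (\<lambda>x. \<Sum>\<^sub>\<infinity>a. g a x *\<^sub>R c a)"
  have K_sum: "((\<lambda>a. K * g a x) has_sum K * norm x) UNIV" for x
    by (rule has_sum_cmult_right[OF g_sum])
  have le: "norm (g a x *\<^sub>R c a) \<le> K * g a x" for a x
    using mult_right_mono[OF c(3) g0] g0 by (simp add: mult.commute)
  have abs: "(\<lambda>a. norm (g a x *\<^sub>R c a)) summable_on UNIV" for x
    by (rule summable_on_comparison_test[OF has_sum_imp_summable[OF K_sum]]) (use le in auto)
  have s_sum: "((\<lambda>a. g a x *\<^sub>R c a) has_sum s x) UNIV" for x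
    unfolding s_def using abs_summable_summable[OF abs] by simp
  have mem: "g a x *\<^sub>R c a \<in> C" for a x
    by (rule scaleR_mem[OF g0 c(1)])
  have s_mem: "s x \<in> C" for x
    by (rule has_sum_mem[OF s_sum mem])
  have s_bound: "norm (s x) \<le> K * norm x" for x
    using norm_has_sum_bound[OF has_sum_infsum[OF abs] s_sum]
      has_sum_mono[OF has_sum_infsum[OF abs] K_sum le] by (rule order_trans)
  have s_approx: "norm (x - T (s x)) \<le> norm x / 2" for x
  proof (cases "x = 0")
    case True
    then have "s x = 0" using s_bound[of x] by simp
    then show ?thesis using True map_zero by simp
  next
    case False
    let ?d = "\<lambda>a. g a x *\<^sub>R (x - norm x *\<^sub>R sgn a)"
    have "((\<lambda>a. g a x *\<^sub>R sgn a) has_sum T (s x)) UNIV"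
      using map_has_sum[OF s_sum mem] by (simp add: map_scaleR g0 c)
    then have "((\<lambda>a. (- norm x) *\<^sub>R (g a x *\<^sub>R sgn a)) has_sum (- norm x) *\<^sub>R T (s x)) UNIV"
      by (rule has_sum_scaleR)
    moreover have "((\<lambda>a. g a x *\<^sub>R x) has_sum norm x *\<^sub>R x) UNIV"
      using has_sum_bounded_linear[OF bounded_linear_scaleR_left g_sum] .
    ultimately have d_sum: "(?d has_sum norm x *\<^sub>R (x - T (s x))) UNIV"
      using has_sum_add by (fastforce simp: scaleR_right_diff_distrib mult.commute)
    have d_le: "norm (?d a) \<le> norm x / 2 * g a x" for a
      using g_near[of a x] g0[of a x] mult_left_mono[of "norm (x - norm x *\<^sub>R sgn a)" "norm x / 2" "g a x"]
      by (cases "g a x = 0") (auto simp: mult.commute)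
    have half: "((\<lambda>a. norm x / 2 * g a x) has_sum norm x / 2 * norm x) UNIV"
      by (rule has_sum_cmult_right[OF g_sum])
    have d_abs: "(\<lambda>a. norm (?d a)) summable_on UNIV"
      by (rule summable_on_comparison_test[OF has_sum_imp_summable[OF half]]) (use d_le in auto)
    have "norm (norm x *\<^sub>R (x - T (s x))) \<le> norm x / 2 * norm x"
      using norm_has_sum_bound[OF has_sum_infsum[OF d_abs] d_sum]
        has_sum_mono[OF has_sum_infsum[OF d_abs] half d_le] by (rule order_trans)
    then have "norm x * norm (x - T (s x)) \<le> norm x * (norm x / 2)" by (simp add: mult.commute)
    then show ?thesis using False using mult_le_cancel_left_pos[of "norm x"] by simp
  qed
  have s_cont: "continuous_on UNIV s"
    by (rule continuous_on_has_sum_scaleR[OF g0 g_cont g_sum _ c(3) s_sum]) (intro continuous_intros)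
  have "s (t *\<^sub>R x) = t *\<^sub>R s x" if "0 \<le> t" for t x
    by (simp add: s_def g_hom that infsum_scaleR_right flip: scaleR_scaleR)
  then have "pos_homogeneous_on UNIV s" by (simp add: pos_homogeneous_on_def)
  with K s_mem s_bound s_approx s_cont show ?thesis by blast
qed

text \<open>
  The terms of the series are bounded by \<open>K \<parallel>x\<parallel> 2^(-n)\<close>, hence uniformly on each ball; continuity is
  therefore obtained ball by ball.
\<close>

lemma continuous_lifting:
  "\<exists>K>0. \<exists>\<gamma>. (\<forall>x. \<gamma> x \<in> C) \<and> continuous_on UNIV \<gamma> \<and> pos_homogeneous_on UNIV \<gamma> \<and>
     (\<forall>x. T (\<gamma> x) = x) \<and> (\<forall>x. norm (\<gamma> x) \<le> K * norm x)"
proof -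
  obtain K s where K: "0 < K" and s: "\<And>x. s x \<in> C" "\<And>x. norm (s x) \<le> K * norm x"
      "\<And>x. norm (x - T (s x)) \<le> norm x / 2"
    and s_cont: "continuous_on UNIV s" and s_hom: "pos_homogeneous_on UNIV s"
    using continuous_approximate_lifting by blast
  define R where "R = (\<lambda>x. x - T (s x))"
  define \<gamma> where "\<gamma> x = (\<Sum>\<^sub>\<infinity>n. s ((R ^^ n) x))" for x
  note approx = successive_approximation[OF s less_imp_le[OF K], folded R_def, folded \<gamma>_def]
  have "continuous_on UNIV (\<lambda>x. T (s x))"
    by (rule continuous_on_compose2[OF cont s_cont]) (use s in auto)
  then have R_cont: "continuous_on UNIV R"
    unfolding R_def by (intro continuous_intros)
  have Rn_cont: "continuous_on UNIV (R ^^ n)" for n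
  proof (induction n)
    case (Suc n)
    then show ?case using continuous_on_compose2[OF R_cont Suc] by (simp add: comp_def)
  qed (simp add: id_def)
  have term_cont: "continuous_on A (\<lambda>x. s ((R ^^ n) x))" for n A
    by (rule continuous_on_subset[OF continuous_on_compose2[OF s_cont Rn_cont]]) auto
  have ball_cont: "continuous_on (ball 0 r) \<gamma>" for r
  proof (rule uniform_limit_theorem)
    have "K * norm x * (1 / 2) ^ n \<le> K * r * (1 / 2) ^ n" if "x \<in> ball 0 r" for x :: 'x and n
      using K that by (simp add: mult_right_mono mult_left_mono)
    then have "norm (s ((R ^^ n) x)) \<le> K * r * (1 / 2) ^ n" if "x \<in> ball 0 r" for x n
      using approx(1) that order_trans by blast
    moreover have "(\<lambda>n. K * r * (1 / 2) ^ n) summable_on (UNIV :: nat set)"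
      by (intro summable_on_cmult_right norm_summable_imp_summable_on) simp
    ultimately show "uniform_limit (ball 0 r) (\<lambda>N x. \<Sum>n\<in>N. s ((R ^^ n) x)) \<gamma> (finite_subsets_at_top UNIV)"
      using approx(2) by (intro Weierstrass_m_test_general') auto
  qed (auto intro!: always_eventually continuous_on_sum term_cont)
  have "continuous_on UNIV \<gamma>"
  proof (rule continuous_at_imp_continuous_on, rule ballI)
    fix x :: 'x
    have "x \<in> ball 0 (norm x + 1)" by simp
    then show "isCont \<gamma> x"
      using ball_cont continuous_on_eq_continuous_at[OF open_ball] by blast
  qed
  moreover have "pos_homogeneous_on UNIV \<gamma>"
    unfolding pos_homogeneous_on_def
  proof (intro allI impI ballI)
    fix t :: real and x :: 'x
    assume t: "0 \<le> t"
    have s_scale: "s (t *\<^sub>R z) = t *\<^sub>R s z" for z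
      using s_hom t by (simp add: pos_homogeneous_on_def)
    have "R (t *\<^sub>R z) = t *\<^sub>R R z" for z
      using s(1) t by (simp add: R_def s_scale map_scaleR scaleR_right_diff_distrib)
    then have "(R ^^ n) (t *\<^sub>R x) = t *\<^sub>R (R ^^ n) x" for n
      by (induction n) auto
    then show "\<gamma> (t *\<^sub>R x) = t *\<^sub>R \<gamma> x"
      by (simp add: \<gamma>_def s_scale infsum_scaleR_right)
  qed
  ultimately show ?thesis
    using approx(3-5) K by (intro exI[of _ "2 * K"] conjI exI[of _ \<gamma>]) auto
qed

end

theorem theorem1p3:
  fixes C :: "'y::banach set" and T :: "'y \<Rightarrow> 'x::banach"
  assumes "closed C"
    and "additive_cone C"
    and "T ` C = UNIV"
    and "continuous_on C T"
    and "additive_on C T"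
    and "pos_homogeneous_on C T"
  shows "\<exists>(K::real) (\<gamma> :: 'x \<Rightarrow> 'y).
           K > 0 \<and> \<gamma> ` UNIV \<subseteq> C \<and> continuous_on UNIV \<gamma> \<and> pos_homogeneous_on UNIV \<gamma> \<and>
           (\<forall>x. T (\<gamma> x) = x) \<and>
           (\<forall>x. norm (\<gamma> x) \<le> K * norm x)"
proof -
  interpret cone_surjection C T
    using assms by unfold_locales
  from continuous_lifting show ?thesis by blast
qed

end
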